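(* Fix an integer $k\ge 1$. For $q\in\mathbb N$ let $J(q,k)$ be the Johnson graph, and let $f_q(n)=\chi_{J(q,k)}(n)$ be its chromatic polynomial. Then $f_q(n)$ is a two-level polynomial of degree function $\binom{q}{k}$ and infinite depth.
   Context: $\mathbb N=\{0,1,2,\dots\}$. The Johnson graph $J(q,k)$ has as vertices the $k$-element subsets of $[q]=\{1,\dots,q\}$, two vertices being adjacent exactly when they share exactly $k-1$ elements. The chromatic polynomial $\chi_G(n)$ counts colorings of the vertices of $G$ with $n$ colors such that adjacent vertices get different colors (it is $1$ for the graph with no vertices). A numerical polynomial is $g\in\mathbb Q[x]$ with $g(q)\in\mathbb Z$ for all $q\in\mathbb Z$. Two-level polynomial: let $g$ be an eventually nonnegative numerical polynomial, $S=\{q\in\mathbb N: g(q)\ge0\}$, $e:S\to\mathbb N\cup\{-1,\infty\}$. A two-level polynomial of degree function $g$ and depth function $e$ is a sequence of polynomials $\{f_q\}_{q\in S}$, $f_q(n)$ of degree $g(q)$, such that, writing $f_q(n)=\sum_{r\ge0}c_r(q)n^{g(q)-r}$ with $c_r(q)=0$ for $r>g(q)$, there exist polynomials $\{\phi_r(q)\}_{r\ge0}$ with $c_r(q)=\phi_r(q)$ for every $q\in S$ and every $r\le e(q)$. Infinite depth means $e(q)=\infty$ for all $q\in S$, i.e. the equality holds for all $r\ge 0$ (including $r>g(q)$, where $\phi_r(q)=0$). *)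

theory Defs
  imports
    Complex_Main
    "HOL-Library.FuncSet"
    "HOL-Library.Extended_Real"
    "HOL-Computational_Algebra.Polynomial"
begin

section \<open>Colorings and the chromatic polynomial\<close>

text \<open>A graph is given by its vertex set \<open>V\<close> and its adjacency relation \<open>adj\<close>, of which only
  the restriction to \<open>V\<close> matters.\<close>

definition proper_colorings :: "'a set \<Rightarrow> ('a \<Rightarrow> 'a \<Rightarrow> bool) \<Rightarrow> nat \<Rightarrow> ('a \<Rightarrow> nat) set" where
  "proper_colorings V adj n =
     {c \<in> V \<rightarrow>\<^sub>E {..<n}. \<forall>u\<in>V. \<forall>v\<in>V. adj u v \<longrightarrow> c u \<noteq> c v}"

text \<open>The description below determines a unique polynomial for every finite \<open>V\<close>; see
  \<open>poly_chromatic_poly\<close>.\<close>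

definition chromatic_poly :: "'a set \<Rightarrow> ('a \<Rightarrow> 'a \<Rightarrow> bool) \<Rightarrow> rat poly" where
  "chromatic_poly V adj =
     (THE p. \<forall>n. poly p (of_nat n) = of_nat (card (proper_colorings V adj n)))"

lemma poly_eq_if_eq_on_nat:
  fixes p p' :: "rat poly"
  assumes "\<And>n. poly p (of_nat n) = poly p' (of_nat n)"
  shows "p = p'"
proof (rule ccontr)
  assume "p \<noteq> p'"
  then have "finite {x. poly (p - p') x = 0}"
    by (intro poly_roots_finite) simp
  moreover have "range (of_nat :: nat \<Rightarrow> rat) \<subseteq> {x. poly (p - p') x = 0}"
    using assms by auto
  ultimately have "finite (range (of_nat :: nat \<Rightarrow> rat))"
    by (rule rev_finite_subset)
  then show False
    using inj_of_nat finite_imageD infinite_UNIV_nat by blast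
qed

text \<open>The polynomial \<open>x (x - 1) \<dots> (x - k + 1) / k!\<close>.\<close>

definition binom_poly :: "nat \<Rightarrow> rat poly" where
  "binom_poly k = smult (1 / fact k) (\<Prod>i<k. [:- of_nat i, 1:])"

lemma poly_binom_poly: "poly (binom_poly k) x = x gchoose k"
  by (simp add: binom_poly_def poly_prod gbinomial_prod_rev atLeast0LessThan)

lemma card_proper_colorings_onto:
  assumes "finite A"
  shows "card {c \<in> V \<rightarrow>\<^sub>E A. c ` V = A \<and> (\<forall>u\<in>V. \<forall>v\<in>V. adj u v \<longrightarrow> c u \<noteq> c v)} =
    card {c \<in> V \<rightarrow>\<^sub>E {..<card A}. c ` V = {..<card A} \<and> (\<forall>u\<in>V. \<forall>v\<in>V. adj u v \<longrightarrow> c u \<noteq> c v)}"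
proof -
  obtain h where h: "bij_betw h A {..<card A}"
    using ex_bij_betw_finite_nat[OF assms] by (auto simp: atLeast0LessThan)
  define h' where "h' = the_inv_into A h"
  have h': "bij_betw h' {..<card A} A"
    unfolding h'_def using h by (rule bij_betw_the_inv_into)
  have inv: "\<And>x. x \<in> A \<Longrightarrow> h' (h x) = x" "\<And>y. y < card A \<Longrightarrow> h (h' y) = y"
    unfolding h'_def using h
    by (auto simp: bij_betw_def the_inv_into_f_f intro!: f_the_inv_into_f)
  have in_range: "\<And>x. x \<in> A \<Longrightarrow> h x < card A" "\<And>y. y < card A \<Longrightarrow> h' y \<in> A"
    using h h' by (auto simp: bij_betw_def)
  show ?thesis
  proof (rule bij_betw_same_card[where f = "\<lambda>c. \<lambda>v\<in>V. h (c v)"],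
         rule bij_betw_byWitness[where f' = "\<lambda>c. \<lambda>v\<in>V. h' (c v)"], goal_cases)
    case 1
    show ?case
      by (auto simp: inv fun_eq_iff restrict_def PiE_def Pi_def extensional_def)
  next
    case 2
    show ?case
      by (auto simp: inv fun_eq_iff restrict_def PiE_def Pi_def extensional_def)
  next
    case 3
    show ?case
    proof (clarify, intro CollectI conjI ballI impI)
      fix c assume c: "c \<in> V \<rightarrow>\<^sub>E c ` V" "A = c ` V"
      show "(\<lambda>v\<in>V. h (c v)) \<in> V \<rightarrow>\<^sub>E {..<card (c ` V)}"
        using in_range c by auto
      have "(\<lambda>v\<in>V. h (c v)) ` V = h ` (c ` V)" by auto
      then show "(\<lambda>v\<in>V. h (c v)) ` V = {..<card (c ` V)}"
        using h c by (simp add: bij_betw_def)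
    next
      fix c u v assume "A = c ` V" "\<forall>u\<in>V. \<forall>v\<in>V. adj u v \<longrightarrow> c u \<noteq> c v"
        "u \<in> V" "v \<in> V" "adj u v"
      then show "(\<lambda>v\<in>V. h (c v)) u \<noteq> (\<lambda>v\<in>V. h (c v)) v"
        using inv by (metis imageI restrict_apply')
    qed
  next
    case 4
    show ?case
    proof (clarify, intro CollectI conjI ballI impI)
      fix c assume c: "c \<in> V \<rightarrow>\<^sub>E {..<card A}" "c ` V = {..<card A}"
      show "(\<lambda>v\<in>V. h' (c v)) \<in> V \<rightarrow>\<^sub>E A"
        using in_range c by auto
      have "(\<lambda>v\<in>V. h' (c v)) ` V = h' ` (c ` V)" by auto
      then show "(\<lambda>v\<in>V. h' (c v)) ` V = A"
        using h' c by (simp add: bij_betw_def)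
    next
      fix c u v assume "c ` V = {..<card A}" "\<forall>u\<in>V. \<forall>v\<in>V. adj u v \<longrightarrow> c u \<noteq> c v"
        "u \<in> V" "v \<in> V" "adj u v"
      then show "(\<lambda>v\<in>V. h' (c v)) u \<noteq> (\<lambda>v\<in>V. h' (c v)) v"
        using inv by (metis imageI lessThan_iff restrict_apply')
    qed
  qed
qed

lemma chromatic_poly_exists:
  assumes "finite V"
  shows "\<exists>p :: rat poly. \<forall>n. poly p (of_nat n) = of_nat (card (proper_colorings V adj n))"
proof -
  define onto where "onto A = {c \<in> V \<rightarrow>\<^sub>E A. c ` V = A \<and>
    (\<forall>u\<in>V. \<forall>v\<in>V. adj u v \<longrightarrow> c u \<noteq> c v)}" for A :: "nat set"
  have fin: "finite (onto A)" if "finite A" for A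
  proof (rule finite_subset)
    show "onto A \<subseteq> V \<rightarrow>\<^sub>E A" by (auto simp: onto_def)
    show "finite (V \<rightarrow>\<^sub>E A)" using assms that by (intro finite_PiE)
  qed
  have empty: "onto {..<j} = {}" if "j > card V" for j
  proof -
    have "card (c ` V) < j" for c :: "'a \<Rightarrow> nat"
      using card_image_le[OF assms, of c] that by simp
    then have "c ` V \<noteq> {..<j}" for c :: "'a \<Rightarrow> nat"
      by (metis card_lessThan less_irrefl)
    then show ?thesis by (simp add: onto_def)
  qed
  have card_eq: "card (proper_colorings V adj n) = (\<Sum>j\<le>card V. card (onto {..<j}) * (n choose j))"
    for n
  proof -
    have "proper_colorings V adj n = (\<Union>A\<in>Pow {..<n}. onto A)"
      by (fastforce simp: proper_colorings_def onto_def PiE_def Pi_def)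
    also have "card \<dots> = (\<Sum>A\<in>Pow {..<n}. card (onto A))"
      proof (rule card_UN_disjoint)
      show "\<forall>A\<in>Pow {..<n}. finite (onto A)"
        by (auto intro: fin dest: finite_subset)
    qed (auto simp: onto_def)
    also have "\<dots> = (\<Sum>A\<in>Pow {..<n}. card (onto {..<card A}))"
      unfolding onto_def
      by (intro sum.cong refl card_proper_colorings_onto) (auto dest: finite_subset)
    also have "\<dots> = (\<Sum>j\<le>n. \<Sum>A\<in>{A\<in>Pow {..<n}. card A = j}. card (onto {..<card A}))"
      by (rule sum.group[symmetric]) (auto intro: card_mono[of "{..<n}", simplified])
    also have "\<dots> = (\<Sum>j\<le>n. card (onto {..<j}) * (n choose j))"
    proof (rule sum.cong[OF refl])
      fix j
      show "(\<Sum>A\<in>{A\<in>Pow {..<n}. card A = j}. card (onto {..<card A})) =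
            card (onto {..<j}) * (n choose j)"
        using n_subsets[of "{..<n}" j] by simp
    qed
    also have "\<dots> = (\<Sum>j\<le>max n (card V). card (onto {..<j}) * (n choose j))"
      by (rule sum.mono_neutral_left) (auto simp: not_le)
    also have "\<dots> = (\<Sum>j\<le>card V. card (onto {..<j}) * (n choose j))"
      by (rule sum.mono_neutral_right) (auto simp: not_le empty)
    finally show ?thesis .
  qed
  have "poly (\<Sum>j\<le>card V. smult (of_nat (card (onto {..<j}))) (binom_poly j)) (of_nat n) =
        of_nat (card (proper_colorings V adj n))" for n
    by (simp add: card_eq poly_sum poly_binom_poly binomial_gbinomial)
  then show ?thesis by blast
qed

lemma poly_chromatic_poly:
  assumes "finite V"
  shows "poly (chromatic_poly V adj) (of_nat n) = of_nat (card (proper_colorings V adj n))"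
proof -
  have "\<exists>!p :: rat poly. \<forall>n. poly p (of_nat n) = of_nat (card (proper_colorings V adj n))"
    using chromatic_poly_exists[OF assms, of adj]
    by (auto intro: poly_eq_if_eq_on_nat)
  from theI'[OF this] show ?thesis
    unfolding chromatic_poly_def by blast
qed

section \<open>Johnson graphs\<close>

definition johnson_vertices :: "nat \<Rightarrow> nat \<Rightarrow> nat set set" where
  "johnson_vertices q k = {A. A \<subseteq> {1..q} \<and> card A = k}"

text \<open>Intended for \<open>k \<ge> 1\<close>, where the relation is irreflexive on the \<open>k\<close>-element sets.\<close>

definition johnson_adj :: "nat \<Rightarrow> nat set \<Rightarrow> nat set \<Rightarrow> bool" where
  "johnson_adj k A B \<longleftrightarrow> card (A \<inter> B) = k - 1"

section \<open>Two-level polynomials\<close>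

definition numerical_poly :: "rat poly \<Rightarrow> bool" where
  "numerical_poly g \<longleftrightarrow> (\<forall>z::int. poly g (of_int z) \<in> \<int>)"

definition nonneg_args :: "rat poly \<Rightarrow> nat set" where
  "nonneg_args g = {q. poly g (of_nat q) \<ge> 0}"

definition desc_coeff :: "'a::zero poly \<Rightarrow> nat \<Rightarrow> 'a" where
  "desc_coeff p r = (if r \<le> degree p then coeff p (degree p - r) else 0)"

text \<open>Depth values range over the naturals together with \<open>-1\<close> and \<open>\<infinity>\<close>, embedded in the
  extended reals. The clause \<open>f q \<noteq> 0\<close> is part of having degree \<open>g q\<close>, since
  \<open>degree 0 = 0\<close> here.\<close>

definition two_level_poly :: "rat poly \<Rightarrow> (nat \<Rightarrow> ereal) \<Rightarrow> (nat \<Rightarrow> rat poly) \<Rightarrow> bool" where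
  "two_level_poly g e f \<longleftrightarrow>
     numerical_poly g \<and>
     (\<forall>\<^sub>F q in sequentially. poly g (of_nat q) \<ge> 0) \<and>
     (\<forall>q\<in>nonneg_args g. e q = -1 \<or> e q = \<infinity> \<or> (\<exists>m::nat. e q = ereal (real m))) \<and>
     (\<forall>q\<in>nonneg_args g. f q \<noteq> 0 \<and> of_nat (degree (f q)) = poly g (of_nat q)) \<and>
     (\<exists>\<phi> :: nat \<Rightarrow> rat poly. \<forall>q\<in>nonneg_args g. \<forall>r.
        ereal (real r) \<le> e q \<longrightarrow> desc_coeff (f q) r = poly (\<phi> r) (of_nat q))"

end

theory Submission imports Defs
begin

text \<open>Inclusion-exclusion over the edges that a coloring makes monochromatic gives Whitney's
  formula: the chromatic polynomial of a graph on \<open>V\<close> is the sum, over all edge sets \<open>S\<close>, of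
  \<open>(-1) ^ |S| n ^ c(S)\<close>, where \<open>c(S)\<close> counts the connected components of \<open>(V, S)\<close>. Write
  \<open>c(S) = |V| - rank S\<close>. The rank depends on \<open>S\<close> alone, not on \<open>V\<close>, because an isolated vertex
  adds one to both \<open>c(S)\<close> and \<open>|V|\<close>. So the coefficient of \<open>n ^ (|V| - r)\<close> is the signed number
  of edge sets of rank \<open>r\<close> (\<open>desc_coeff_chromatic_poly\<close>).

  For the Johnson graph \<open>J(q, k)\<close>, sort these edge sets by their ground set \<open>T\<close>, the union of
  all the \<open>k\<close>-sets that occur as end points. Two facts make the count a polynomial in \<open>q\<close>.
  First, a nontrivial component has at least two vertices, so an edge set of rank \<open>r\<close> touches at
  most \<open>2 r\<close> vertices and its ground set has at most \<open>2 k r\<close> elements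
  (\<open>card_ground_set_le\<close>). Second, permuting the ground elements shows that the signed number
  of edge sets with ground set \<open>T\<close> depends only on \<open>|T|\<close> (\<open>signed_count_cong\<close>), and it does
  not mention \<open>q\<close>. Since \<open>{1..q}\<close> has \<open>q choose m\<close> subsets of size \<open>m\<close>, the coefficient is a
  fixed linear combination of the \<open>q choose m\<close> with \<open>m \<le> 2 k r\<close>. This holds for every \<open>q\<close> and
  \<open>r\<close>, which is infinite depth; for \<open>r\<close> above the number of vertices the count is empty.\<close>

section \<open>Connected components of an edge set\<close>

definition connectivity :: "('a \<times> 'a) set \<Rightarrow> ('a \<times> 'a) set" where
  "connectivity S = (S \<union> S\<inverse>)\<^sup>*"

text \<open>The rank of the graphic matroid: vertices minus components. Counting only on
  \<open>Field S\<close> keeps the ambient vertex set out of the definition.\<close>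

definition edge_rank :: "('a \<times> 'a) set \<Rightarrow> nat" where
  "edge_rank S = card (Field S) - card (Field S // connectivity S)"

lemma equiv_connectivity: "equiv UNIV (connectivity S)"
proof -
  have "sym (S \<union> S\<inverse>)" by (auto simp: sym_def)
  then show ?thesis
    unfolding connectivity_def
    by (intro equivI) (auto intro: refl_rtrancl sym_rtrancl trans_rtrancl)
qed

lemma connectivity_outside_Field:
  assumes "(u, v) \<in> connectivity S" and "u \<notin> Field S"
  shows "v = u"
  using assms unfolding connectivity_def
  by (induction rule: rtrancl_induct) (auto simp: Field_def)

lemma connectivity_within_Field:
  assumes "(u, v) \<in> connectivity S" and "u \<in> Field S"
  shows "v \<in> Field S"
  using assms unfolding connectivity_def
  by (induction rule: rtrancl_induct) (auto simp: Field_def)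

lemma connectivity_class_outside_Field:
  assumes "u \<notin> Field S"
  shows "connectivity S `` {u} = {u}"
  using connectivity_outside_Field[OF _ assms] by (auto simp: connectivity_def)

lemma connectivity_constant:
  assumes "(u, v) \<in> connectivity S" and "\<And>x y. (x, y) \<in> S \<Longrightarrow> c x = c y"
  shows "c u = c v"
  using assms(1) unfolding connectivity_def
  by (induction rule: rtrancl_induct) (auto simp: assms(2))

lemma quotient_eq_image: "A // R = (\<lambda>x. R `` {x}) ` A"
  by (auto simp: quotient_def)

lemma card_components_le:
  assumes "finite V"
  shows "card (V // connectivity S) \<le> card V"
  using assms by (simp add: quotient_eq_image card_image_le)

text \<open>Outside \<open>Field S\<close> every vertex is a component by itself, so it does not change the
  difference between the numbers of vertices and of components.\<close>

lemma card_components: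
  assumes "finite V" and "Field S \<subseteq> V"
  shows "card (V // connectivity S) = card V - edge_rank S"
    and "edge_rank S \<le> card V"
proof -
  let ?Q = "Field S // connectivity S" and ?I = "(\<lambda>v. {v}) ` (V - Field S)"
  have finF: "finite (Field S)" using assms finite_subset by blast
  have "V // connectivity S = ?Q \<union> ?I"
  proof -
    have "V // connectivity S = ?Q \<union> (V - Field S) // connectivity S"
      using assms(2) by (auto simp: quotient_def)
    also have "(V - Field S) // connectivity S = ?I"
      by (auto simp: quotient_def connectivity_class_outside_Field)
    finally show ?thesis .
  qed
  moreover have "?Q \<inter> ?I = {}"
    using connectivity_within_Field by (fastforce simp: quotient_def)
  moreover have "finite ?Q"
    using finF by (simp add: quotient_def)
  moreover have "card ?I = card V - card (Field S)"
    using assms finF by (subst card_image) (auto simp: card_Diff_subset)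
  ultimately have "card (V // connectivity S) = card ?Q + (card V - card (Field S))"
    using assms(1) by (simp add: card_Un_disjoint)
  moreover have "card ?Q \<le> card (Field S)" "card (Field S) \<le> card V"
    using card_components_le[OF finF] card_mono[OF assms] by auto
  ultimately show "card (V // connectivity S) = card V - edge_rank S" "edge_rank S \<le> card V"
    by (auto simp: edge_rank_def)
qed

text \<open>Every component of a loop-free edge set that meets \<open>Field S\<close> contains an edge, hence two
  distinct vertices, so there are at most half as many components as vertices.\<close>

lemma card_Field_le_edge_rank:
  assumes "finite (Field S)" and "irrefl S"
  shows "card (Field S) \<le> 2 * edge_rank S"
proof -
  let ?Q = "Field S // connectivity S"
  have sub: "C \<subseteq> Field S" if "C \<in> ?Q" for C
    using that connectivity_within_Field by (fastforce simp: quotient_def)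
  have two: "2 \<le> card C" if "C \<in> ?Q" for C
  proof -
    obtain u where u: "u \<in> Field S" "C = connectivity S `` {u}"
      using \<open>C \<in> ?Q\<close> by (auto simp: quotient_def)
    obtain v where v: "(u, v) \<in> S \<union> S\<inverse>"
      using u by (auto simp: Field_def)
    then have "u \<noteq> v" using assms(2) by (auto simp: irrefl_def)
    moreover have "{u, v} \<subseteq> C" using v u(2) by (auto simp: connectivity_def)
    moreover have "finite C" using sub[OF that] assms(1) finite_subset by blast
    ultimately show ?thesis using card_mono[of C "{u, v}"] by simp
  qed
  have "\<Union>?Q = Field S"
    using sub by (auto simp: quotient_def connectivity_def)
  moreover have "pairwise disjnt ?Q"
  proof -
    have "?Q \<subseteq> UNIV // connectivity S" by (auto simp: quotient_def)
    then show ?thesis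
      using quotient_disj[OF equiv_connectivity]
      unfolding pairwise_def disjnt_def by (meson subsetD)
  qed
  ultimately have "card (Field S) = (\<Sum>C\<in>?Q. card C)"
    using card_Union_disjoint[of ?Q] sub assms(1) finite_subset by metis
  also have "\<dots> \<ge> (\<Sum>C\<in>?Q. 2)"
    by (intro sum_mono two)
  finally have "2 * card ?Q \<le> card (Field S)" by simp
  then show ?thesis by (simp add: edge_rank_def)
qed

lemma edge_rank_eq_0_iff:
  assumes "finite (Field S)" and "irrefl S"
  shows "edge_rank S = 0 \<longleftrightarrow> S = {}"
proof
  assume "edge_rank S = 0"
  then have "Field S = {}" using card_Field_le_edge_rank[OF assms] assms(1) by simp
  then show "S = {}" by (auto simp: Field_def)
qed (simp add: edge_rank_def)

lemma Field_map_prod: "Field (map_prod f f ` S) = f ` Field S"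
  by (force simp: Field_def)

lemma connectivity_map_prod:
  assumes "(u, v) \<in> connectivity S"
  shows "(f u, f v) \<in> connectivity (map_prod f f ` S)"
  using assms unfolding connectivity_def
proof (induction rule: rtrancl_induct)
  case (step y z)
  then have "(f y, f z) \<in> map_prod f f ` S \<union> (map_prod f f ` S)\<inverse>" by force
  with step.IH show ?case by (rule rtrancl_into_rtrancl)
qed simp

lemma connectivity_map_prod_iff:
  assumes "bij f"
  shows "(f u, f v) \<in> connectivity (map_prod f f ` S) \<longleftrightarrow> (u, v) \<in> connectivity S"
proof
  assume "(f u, f v) \<in> connectivity (map_prod f f ` S)"
  moreover have "map_prod (inv f) (inv f) ` map_prod f f ` S = S"
    using bij_is_inj[OF assms] by (simp add: image_image map_prod_def case_prod_unfold)
  ultimately show "(u, v) \<in> connectivity S"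
    using connectivity_map_prod[of "f u" "f v" "map_prod f f ` S" "inv f"] bij_is_inj[OF assms]
    by simp
next
  assume "(u, v) \<in> connectivity S"
  then show "(f u, f v) \<in> connectivity (map_prod f f ` S)"
    by (rule connectivity_map_prod[of u v S f])
qed

lemma edge_rank_map_prod:
  assumes "bij f"
  shows "edge_rank (map_prod f f ` S) = edge_rank S"
proof -
  let ?S = "map_prod f f ` S"
  have inj: "inj f" using assms by (rule bij_is_inj)
  have "connectivity ?S `` {f u} = f ` (connectivity S `` {u})" for u
  proof (rule set_eqI)
    fix w
    obtain v where w: "w = f v" using bij_is_surj[OF assms] by (rule surjE)
    show "w \<in> connectivity ?S `` {f u} \<longleftrightarrow> w \<in> f ` (connectivity S `` {u})"
      unfolding w Image_singleton_iff connectivity_map_prod_iff[OF assms]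
        inj_image_mem_iff[OF inj] by (rule refl)
  qed
  then have "Field ?S // connectivity ?S = (`) f ` (Field S // connectivity S)"
    by (simp add: quotient_eq_image Field_map_prod image_image)
  moreover have "card ((`) f ` (Field S // connectivity S)) = card (Field S // connectivity S)"
    by (intro card_image inj_onI) (simp add: inj_image_eq_iff[OF inj])
  moreover have "card (f ` Field S) = card (Field S)"
    by (rule card_image[OF inj_on_subset[OF inj subset_UNIV]])
  ultimately show ?thesis
    unfolding edge_rank_def Field_map_prod by (simp only:)
qed

section \<open>The edge set expansion of the chromatic polynomial\<close>

text \<open>A coloring that is constant along the edges of \<open>S\<close> is the same as a free choice of one
  color for each component.\<close>

lemma card_constant_colorings:
  assumes "finite V" and "Field S \<subseteq> V"
  shows "card {c \<in> V \<rightarrow>\<^sub>E {..<n}. \<forall>(u, v)\<in>S. c u = c v} =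
    n ^ card (V // connectivity S)"
proof -
  let ?Q = "V // connectivity S" and ?K = "\<lambda>v. connectivity S `` {v}"
  let ?F = "\<lambda>g. \<lambda>v\<in>V. g (?K v)"
  have QV: "?Q = ?K ` V" by (rule quotient_eq_image)
  have K_eq: "?K u = ?K v" if "(u, v) \<in> connectivity S" for u v
    using that equiv_connectivity by (rule equiv_class_eq[rotated])
  have "bij_betw ?F (?Q \<rightarrow>\<^sub>E {..<n}) {c \<in> V \<rightarrow>\<^sub>E {..<n}. \<forall>(u, v)\<in>S. c u = c v}"
    unfolding bij_betw_def
  proof
    show "inj_on ?F (?Q \<rightarrow>\<^sub>E {..<n})"
    proof (rule inj_onI)
      fix g g' assume g: "g \<in> ?Q \<rightarrow>\<^sub>E {..<n}" "g' \<in> ?Q \<rightarrow>\<^sub>E {..<n}" and eq: "?F g = ?F g'"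
      have "g (?K v) = g' (?K v)" if "v \<in> V" for v
        using fun_cong[OF eq, of v] that by simp
      then show "g = g'"
        using g by (intro PiE_ext[OF g]) (auto simp: QV)
    qed
    show "?F ` (?Q \<rightarrow>\<^sub>E {..<n}) = {c \<in> V \<rightarrow>\<^sub>E {..<n}. \<forall>(u, v)\<in>S. c u = c v}" (is "_ = ?C")
    proof
      show "?F ` (?Q \<rightarrow>\<^sub>E {..<n}) \<subseteq> ?C"
      proof (intro image_subsetI CollectI conjI)
        fix g assume g: "g \<in> ?Q \<rightarrow>\<^sub>E {..<n}"
        show "?F g \<in> V \<rightarrow>\<^sub>E {..<n}"
          using g by (auto simp: QV)
        have "?K u = ?K v" if "(u, v) \<in> S" for u v
          using that by (intro K_eq) (auto simp: connectivity_def)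
        then show "\<forall>(u, v)\<in>S. ?F g u = ?F g v"
          using assms(2) by (auto simp: Field_def subset_iff)
      qed
      show "?C \<subseteq> ?F ` (?Q \<rightarrow>\<^sub>E {..<n})"
      proof
        fix c assume c: "c \<in> ?C"
        define g where "g = (\<lambda>C\<in>?Q. c (SOME v. v \<in> C))"
        have gK: "g (?K v) = c v" if "v \<in> V" for v
        proof -
          have "v \<in> ?K v" by (simp add: connectivity_def)
          then have "(SOME u. u \<in> ?K v) \<in> ?K v" by (rule someI)
          then have "c v = c (SOME u. u \<in> ?K v)"
            using c by (intro connectivity_constant[of v _ S]) auto
          then show ?thesis using that by (simp add: g_def QV)
        qed
        have "g \<in> ?Q \<rightarrow>\<^sub>E {..<n}"
        proof (rule PiE_I)
          fix C assume "C \<in> ?Q"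
          then obtain v where "v \<in> V" "C = ?K v" by (auto simp: QV)
          then show "g C \<in> {..<n}" using gK c by auto
        qed (simp add: g_def)
        moreover have "c = ?F g"
        proof (rule PiE_ext)
          show "c \<in> V \<rightarrow>\<^sub>E {..<n}" using c by simp
          show "?F g \<in> V \<rightarrow>\<^sub>E {..<n}" using c gK by auto
        qed (simp add: gK)
        ultimately show "c \<in> ?F ` (?Q \<rightarrow>\<^sub>E {..<n})" by blast
      qed
    qed
  qed
  then have "card {c \<in> V \<rightarrow>\<^sub>E {..<n}. \<forall>(u, v)\<in>S. c u = c v} = card (?Q \<rightarrow>\<^sub>E {..<n})"
    by (rule bij_betw_same_card[symmetric])
  also have "\<dots> = n ^ card ?Q"
    using assms(1) by (simp add: card_PiE QV)
  finally show ?thesis .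
qed

text \<open>Ordered pairs: a symmetric adjacency relation contributes each edge twice. The
  inclusion-exclusion below allows this, since it only treats edges as constraints
  \<open>c u \<noteq> c v\<close>, and a repeated constraint excludes nothing new.\<close>

definition edges :: "'a set \<Rightarrow> ('a \<Rightarrow> 'a \<Rightarrow> bool) \<Rightarrow> ('a \<times> 'a) set" where
  "edges V adj = {(u, v) \<in> V \<times> V. adj u v}"

lemma finite_edges: "finite V \<Longrightarrow> finite (edges V adj)"
  unfolding edges_def by (rule finite_subset[of _ "V \<times> V"]) auto

lemma Field_edges: "S \<subseteq> edges V adj \<Longrightarrow> Field S \<subseteq> V"
  by (auto simp: edges_def Field_def)

text \<open>The indicator of being proper is the product over all edges \<open>e\<close> of
  \<open>1 - [e is monochromatic]\<close>. Multiplying out and summing over colorings leaves, for each edge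
  set, the number of colorings constant along it.\<close>

lemma chromatic_poly_expansion:
  assumes V: "finite V"
  shows "chromatic_poly V adj =
    (\<Sum>S\<in>Pow (edges V adj). monom ((-1) ^ card S) (card V - edge_rank S))"
proof (rule poly_eq_if_eq_on_nat)
  fix n :: nat
  let ?E = "edges V adj" and ?A = "V \<rightarrow>\<^sub>E {..<n}"
  define agree :: "('a \<Rightarrow> nat) \<Rightarrow> 'a \<times> 'a \<Rightarrow> bool" where "agree c e \<longleftrightarrow> c (fst e) = c (snd e)" for c e
  have finE: "finite ?E" using V by (rule finite_edges)
  have finA: "finite ?A" using V by (intro finite_PiE) auto
  have prod_ind: "(\<Prod>e\<in>S. of_bool (P e)) = (of_bool (\<forall>e\<in>S. P e) :: rat)" if "finite S" for S :: "('a \<times> 'a) set" and P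
    using that by induction auto
  have "poly (chromatic_poly V adj) (of_nat n) = of_nat (card (proper_colorings V adj n))"
    by (rule poly_chromatic_poly[OF V])
  also have "proper_colorings V adj n = {c \<in> ?A. \<forall>e\<in>?E. \<not> agree c e}"
    by (auto simp: proper_colorings_def edges_def agree_def)
  also have "of_nat (card {c \<in> ?A. \<forall>e\<in>?E. \<not> agree c e}) = (\<Sum>c\<in>?A. of_bool (\<forall>e\<in>?E. \<not> agree c e) :: rat)"
    using finA by (simp add: sum.If_cases of_bool_def Int_def)
  also have "\<dots> = (\<Sum>c\<in>?A. \<Prod>e\<in>?E. 1 - of_bool (agree c e))"
    by (intro sum.cong refl, subst prod_ind[OF finE, symmetric]) (simp add: of_bool_not_iff)
  also have "\<dots> = (\<Sum>c\<in>?A. \<Sum>S\<in>Pow ?E. (-1) ^ card S * of_bool (\<forall>e\<in>S. agree c e))"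
    using finE finite_subset[OF _ finE]
    by (auto simp: prod_diff_conv_sum prod_ind intro!: sum.cong)
  also have "\<dots> = (\<Sum>S\<in>Pow ?E. \<Sum>c\<in>?A. (-1) ^ card S * of_bool (\<forall>e\<in>S. agree c e))"
    by (rule sum.swap)
  also have "\<dots> = (\<Sum>S\<in>Pow ?E. (-1) ^ card S * of_nat (card {c \<in> ?A. \<forall>(u, v)\<in>S. c u = c v}))"
    using finA by (simp add: sum_distrib_left[symmetric] sum.If_cases of_bool_def Int_def agree_def case_prod_unfold)
  also have "\<dots> = (\<Sum>S\<in>Pow ?E. (-1) ^ card S * of_nat n ^ (card V - edge_rank S))"
    using V Field_edges
    by (intro sum.cong refl) (simp add: card_constant_colorings card_components Field_edges)
  also have "\<dots> = poly (\<Sum>S\<in>Pow ?E. monom ((-1) ^ card S) (card V - edge_rank S)) (of_nat n)"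
    by (simp add: poly_sum poly_monom)
  finally show "poly (chromatic_poly V adj) (of_nat n) = \<dots>" .
qed

lemma irrefl_subset: "irrefl R \<Longrightarrow> S \<subseteq> R \<Longrightarrow> irrefl S"
  by (auto simp: irrefl_def)

lemma coeff_chromatic_poly:
  assumes V: "finite V" and "r \<le> card V"
  shows "coeff (chromatic_poly V adj) (card V - r) =
    (\<Sum>S | S \<subseteq> edges V adj \<and> edge_rank S = r. (-1) ^ card S)"
proof -
  have "coeff (chromatic_poly V adj) (card V - r) =
    (\<Sum>S\<in>Pow (edges V adj). if edge_rank S = r then (-1) ^ card S else 0)"
    unfolding chromatic_poly_expansion[OF V] coeff_sum
  proof (rule sum.cong[OF refl])
    fix S assume "S \<in> Pow (edges V adj)"
    then have "edge_rank S \<le> card V"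
      using V by (intro card_components Field_edges) auto
    then show "coeff (monom ((-1) ^ card S) (card V - edge_rank S)) (card V - r) =
        (if edge_rank S = r then (-1) ^ card S else (0 :: rat))"
      using assms(2) by auto
  qed
  also have "\<dots> = (\<Sum>S | S \<subseteq> edges V adj \<and> edge_rank S = r. (-1) ^ card S)"
    using finite_edges[OF V] by (simp add: sum.If_cases Int_def)
  finally show ?thesis .
qed

text \<open>Without loops the empty edge set is the only one of rank \<open>0\<close>, so the top coefficient
  is \<open>1\<close>.\<close>

lemma degree_chromatic_poly:
  assumes V: "finite V" and irr: "irrefl (edges V adj)"
  shows "chromatic_poly V adj \<noteq> 0" and "degree (chromatic_poly V adj) = card V"
proof -
  have "{S. S \<subseteq> edges V adj \<and> edge_rank S = 0} = {{}}"
  proof -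
    have "edge_rank S = 0 \<longleftrightarrow> S = {}" if "S \<subseteq> edges V adj" for S
      using that irr V by (intro edge_rank_eq_0_iff)
        (auto intro: irrefl_subset finite_subset[OF Field_edges[OF that]])
    then show ?thesis by auto
  qed
  then have one: "coeff (chromatic_poly V adj) (card V) = 1"
    using coeff_chromatic_poly[OF V, of 0 adj] by simp
  then show "chromatic_poly V adj \<noteq> 0" by auto
  have "degree (chromatic_poly V adj) \<le> card V"
    unfolding chromatic_poly_expansion[OF V]
    by (intro degree_sum_le) (auto simp: V finite_edges intro: order.trans[OF degree_monom_le])
  moreover have "card V \<le> degree (chromatic_poly V adj)"
    using one by (intro le_degree) simp
  ultimately show "degree (chromatic_poly V adj) = card V" by simp
qed

text \<open>Since \<open>desc_coeff\<close> is \<open>0\<close> beyond the degree and no edge set has rank above \<open>card V\<close>,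
  the signed count is right for every \<open>r\<close>.\<close>

lemma desc_coeff_chromatic_poly:
  assumes V: "finite V" and irr: "irrefl (edges V adj)"
  shows "desc_coeff (chromatic_poly V adj) r =
    (\<Sum>S | S \<subseteq> edges V adj \<and> edge_rank S = r. (-1) ^ card S)"
proof (cases "r \<le> card V")
  case True
  then show ?thesis
    by (simp add: desc_coeff_def degree_chromatic_poly[OF assms] coeff_chromatic_poly[OF V])
next
  case False
  have "edge_rank S \<le> card V" if "S \<subseteq> edges V adj" for S
    using V that by (intro card_components Field_edges)
  then have "{S. S \<subseteq> edges V adj \<and> edge_rank S = r} = {}"
    using False by auto
  then show ?thesis
    using False by (simp only: sum.empty) (simp add: desc_coeff_def degree_chromatic_poly[OF assms])
qed

section \<open>Edge sets of Johnson graphs by their ground set\<close>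

text \<open>The edges of the infinite Johnson graph, whose vertices are the \<open>k\<close>-sets of natural numbers.
  Its edge sets with ground set inside \<open>{1..q}\<close> are those of \<open>J(q, k)\<close>
  (\<open>subset_johnson_edges_iff\<close>), so \<open>q\<close> enters only through the choice of the ground set.\<close>

definition johnson_pairs :: "nat \<Rightarrow> (nat set \<times> nat set) set" where
  "johnson_pairs k = {(A, B). card A = k \<and> card B = k \<and> johnson_adj k A B}"

definition edge_sets_on :: "nat \<Rightarrow> nat \<Rightarrow> nat set \<Rightarrow> (nat set \<times> nat set) set set" where
  "edge_sets_on k r T = {S. S \<subseteq> johnson_pairs k \<and> \<Union>(Field S) = T \<and> edge_rank S = r}"

definition signed_count :: "nat \<Rightarrow> nat \<Rightarrow> nat set \<Rightarrow> rat" where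
  "signed_count k r T = (\<Sum>S\<in>edge_sets_on k r T. (-1) ^ card S)"

lemma irrefl_johnson_pairs:
  assumes "k \<ge> 1"
  shows "irrefl (johnson_pairs k)"
  using assms by (auto simp: irrefl_def johnson_pairs_def johnson_adj_def)

text \<open>A bijection of the whole type, rather than one from \<open>T\<close> to \<open>U\<close>, so that its image map is a
  bijection on all vertices and its inverse acts in the same way.\<close>

lemma bij_exchanging_sets:
  fixes T U :: "'a set"
  assumes "finite T" "finite U" "card T = card U"
  obtains p :: "'a \<Rightarrow> 'a" where "bij p" "p ` T = U"
proof -
  have "card (T - U) = card (U - T)"
    using assms by (metis card_le_sym_Diff card_le_sym_Diff le_antisym le_refl)
  then obtain g where g: "bij_betw g (U - T) (T - U)"
    using assms by (metis finite_Diff finite_same_card_bij)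
  obtain h where h: "bij_betw h T U"
    using assms finite_same_card_bij by blast
  define p where "p x = (if x \<in> T then h x else if x \<in> U then g x else x)" for x
  have hT: "bij_betw p T U"
    using h by (rule bij_betw_cong[THEN iffD1, rotated]) (simp add: p_def)
  have "bij_betw p (U - T) (T - U)"
    using g by (rule bij_betw_cong[THEN iffD1, rotated]) (simp add: p_def)
  with hT have "bij_betw p (T \<union> (U - T)) (U \<union> (T - U))"
    by (rule bij_betw_combine) auto
  moreover have "bij_betw p (- (T \<union> U)) (- (T \<union> U))"
    by (rule bij_betw_cong[THEN iffD1, rotated, OF bij_betw_id]) (simp add: p_def)
  ultimately have "bij_betw p ((T \<union> (U - T)) \<union> - (T \<union> U)) ((U \<union> (T - U)) \<union> - (T \<union> U))"
    by (rule bij_betw_combine) auto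
  moreover have "(T \<union> (U - T)) \<union> - (T \<union> U) = UNIV" "(U \<union> (T - U)) \<union> - (T \<union> U) = UNIV"
    by auto
  ultimately have "bij p" by simp
  moreover have "p ` T = U" using hT by (simp add: bij_betw_def)
  ultimately show thesis by (rule that)
qed

lemma map_prod_image_edge_sets_on:
  assumes p: "bij p" and S: "S \<in> edge_sets_on k r T"
  shows "map_prod ((`) p) ((`) p) ` S \<in> edge_sets_on k r (p ` T)"
proof -
  have inj: "inj p" using p by (rule bij_is_inj)
  have bij: "bij ((`) p)"
    using p by (metis bij_betw_Pow Pow_UNIV)
  have "map_prod ((`) p) ((`) p) ` S \<subseteq> johnson_pairs k"
    using S inj by (force simp: edge_sets_on_def johnson_pairs_def johnson_adj_def
        card_image inj_on_subset image_Int[symmetric])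
  moreover have "\<Union>(Field (map_prod ((`) p) ((`) p) ` S)) = p ` T"
    using S by (auto simp: edge_sets_on_def Field_map_prod)
  moreover have "edge_rank (map_prod ((`) p) ((`) p) ` S) = r"
    using S by (simp add: edge_sets_on_def edge_rank_map_prod[OF bij])
  ultimately show ?thesis by (simp add: edge_sets_on_def)
qed

text \<open>A permutation that carries \<open>T\<close> to \<open>U\<close> acts on \<open>johnson_pairs\<close>, and it
  preserves the rank and the size of an edge set.\<close>

lemma signed_count_cong:
  assumes "finite T" "finite U" "card T = card U"
  shows "signed_count k r T = signed_count k r U"
proof -
  obtain p where p: "bij p" "p ` T = U"
    using bij_exchanging_sets[OF assms] .
  let ?f = "\<lambda>p. (`) (map_prod ((`) p) ((`) p)) :: (nat set \<times> nat set) set \<Rightarrow> _"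
  have cancel_image: "inv p ` p ` X = X" "p ` inv p ` X = X" for X
    using p by (simp_all add: bij_is_inj bij_is_surj image_inv_f_f image_f_inv_f)
  have cancel: "map_prod ((`) (inv p)) ((`) (inv p)) (map_prod ((`) p) ((`) p) e) = e"
    "map_prod ((`) p) ((`) p) (map_prod ((`) (inv p)) ((`) (inv p)) e) = e" for e
    by (cases e, simp add: cancel_image)+
  then have fg: "?f (inv p) (?f p S) = S" "?f p (?f (inv p) S) = S" for S
    by (simp_all add: image_image)
  show ?thesis
    unfolding signed_count_def
  proof (rule sum.reindex_bij_witness[where i = "?f (inv p)" and j = "?f p"])
    fix S assume S: "S \<in> edge_sets_on k r T"
    show "?f p S \<in> edge_sets_on k r U"
      using map_prod_image_edge_sets_on[OF p(1) S] p(2) by simp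
    have "inj_on (map_prod ((`) p) ((`) p)) S"
      by (rule inj_on_inverseI) (rule cancel(1))
    then show "(-1) ^ card (?f p S) = ((-1) ^ card S :: rat)"
      by (simp add: card_image)
  next
    fix S assume "S \<in> edge_sets_on k r U"
    from map_prod_image_edge_sets_on[OF bij_imp_bij_inv[OF p(1)] this]
    show "?f (inv p) S \<in> edge_sets_on k r T"
      unfolding p(2)[symmetric] cancel_image(1) .
  qed (rule fg)+
qed

text \<open>The ground set is covered by at most \<open>2 r\<close> vertices, each a \<open>k\<close>-set. This bound is
  independent of \<open>q\<close> and limits the degree of the coefficient polynomials.\<close>

lemma card_ground_set_le:
  assumes "k \<ge> 1" and "finite T" and S: "S \<in> edge_sets_on k r T"
  shows "card T \<le> 2 * k * r"
proof -
  have T: "\<Union>(Field S) = T" and r: "edge_rank S = r" and sub: "S \<subseteq> johnson_pairs k"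
    using S by (simp_all add: edge_sets_on_def)
  have fin: "finite (Field S)"
  proof (rule finite_subset)
    show "Field S \<subseteq> Pow T" using T by blast
  qed (simp add: assms(2))
  have "card T \<le> (\<Sum>A\<in>Field S. card A)"
    using card_UN_le[OF fin, of "\<lambda>A. A"] by (simp add: T)
  also have "\<dots> = (\<Sum>A\<in>Field S. k)"
    using sub by (intro sum.cong refl) (auto simp: Field_def johnson_pairs_def)
  also have "\<dots> = k * card (Field S)" by simp
  also have "\<dots> \<le> k * (2 * edge_rank S)"
    using irrefl_johnson_pairs[OF assms(1)] sub
    by (intro mult_left_mono card_Field_le_edge_rank fin) (auto intro: irrefl_subset)
  finally show ?thesis by (simp add: r)
qed

lemma finite_johnson_vertices: "finite (johnson_vertices q k)"
  by (rule finite_subset[of _ "Pow {1..q}"]) (auto simp: johnson_vertices_def)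

lemma card_johnson_vertices: "card (johnson_vertices q k) = q choose k"
  using n_subsets[of "{1..q}" k] by (simp add: johnson_vertices_def)

lemma subset_johnson_edges_iff:
  "S \<subseteq> edges (johnson_vertices q k) (johnson_adj k) \<longleftrightarrow>
     S \<subseteq> johnson_pairs k \<and> \<Union>(Field S) \<subseteq> {1..q}"
proof
  assume S: "S \<subseteq> edges (johnson_vertices q k) (johnson_adj k)"
  have "edges (johnson_vertices q k) (johnson_adj k) \<subseteq> johnson_pairs k"
    by (auto simp: edges_def johnson_pairs_def johnson_vertices_def)
  moreover have "A \<subseteq> {1..q}" if "A \<in> Field S" for A
    using subsetD[OF Field_edges[OF S] that] by (simp add: johnson_vertices_def)
  ultimately show "S \<subseteq> johnson_pairs k \<and> \<Union>(Field S) \<subseteq> {1..q}"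
    using S by blast
next
  assume S: "S \<subseteq> johnson_pairs k \<and> \<Union>(Field S) \<subseteq> {1..q}"
  show "S \<subseteq> edges (johnson_vertices q k) (johnson_adj k)"
  proof (rule subrelI)
    fix A B assume AB: "(A, B) \<in> S"
    then have "A \<in> Field S" "B \<in> Field S" by (auto simp: Field_def)
    with S have "A \<subseteq> {1..q}" "B \<subseteq> {1..q}" by blast+
    then show "(A, B) \<in> edges (johnson_vertices q k) (johnson_adj k)"
      using S AB by (auto simp: edges_def johnson_pairs_def johnson_vertices_def)
  qed
qed

lemma irrefl_johnson_edges:
  assumes "k \<ge> 1"
  shows "irrefl (edges (johnson_vertices q k) (johnson_adj k))"
  using irrefl_johnson_pairs[OF assms] subset_johnson_edges_iff by (blast intro: irrefl_subset)

text \<open>Edge sets of rank \<open>r\<close> are grouped by ground set, and ground sets by size: the set size \<open>m\<close>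
  occurs for \<open>q choose m\<close> ground sets, each with the same signed count.\<close>

lemma desc_coeff_johnson:
  assumes "k \<ge> 1"
  shows "desc_coeff (chromatic_poly (johnson_vertices q k) (johnson_adj k)) r =
    poly (\<Sum>m\<le>2 * k * r. smult (signed_count k r {1..m}) (binom_poly m)) (of_nat q)"
proof -
  let ?E = "edges (johnson_vertices q k) (johnson_adj k)"
  let ?X = "{S. S \<subseteq> ?E \<and> edge_rank S = r}"
  let ?B = "{T. T \<subseteq> {1..q} \<and> card T \<le> 2 * k * r}"
  have finX: "finite ?X"
    by (rule finite_subset[of _ "Pow ?E"]) (auto simp: finite_edges finite_johnson_vertices)
  have finB: "finite ?B"
    by (rule finite_subset[of _ "Pow {1..q}"]) auto
  have on_ground: "{S \<in> ?X. \<Union>(Field S) = T} = edge_sets_on k r T" if "T \<subseteq> {1..q}" for T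
    using that by (auto simp: edge_sets_on_def subset_johnson_edges_iff)
  have "(\<lambda>S. \<Union>(Field S)) ` ?X \<subseteq> ?B"
  proof (rule image_subsetI)
    fix S assume "S \<in> ?X"
    then have sub: "\<Union>(Field S) \<subseteq> {1..q}" and "S \<in> edge_sets_on k r (\<Union>(Field S))"
      by (auto simp: edge_sets_on_def subset_johnson_edges_iff)
    then show "\<Union>(Field S) \<in> ?B"
      using card_ground_set_le[OF assms finite_subset[OF sub]] by simp
  qed
  then have "(\<Sum>S\<in>?X. (-1) ^ card S) =
      (\<Sum>T\<in>?B. \<Sum>S\<in>{S \<in> ?X. \<Union>(Field S) = T}. (-1) ^ card S :: rat)"
    by (rule sum.group[OF finX finB, symmetric])
  also have "\<dots> = (\<Sum>T\<in>?B. signed_count k r {1..card T})"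
  proof (rule sum.cong[OF refl])
    fix T assume T: "T \<in> ?B"
    then have "finite T" using finite_subset by blast
    then have "signed_count k r T = signed_count k r {1..card T}"
      by (intro signed_count_cong) auto
    then show "(\<Sum>S\<in>{S \<in> ?X. \<Union>(Field S) = T}. (-1) ^ card S) = signed_count k r {1..card T}"
      using T on_ground[of T] by (simp add: signed_count_def)
  qed
  also have "\<dots> = (\<Sum>m\<le>2 * k * r. \<Sum>T\<in>{T \<in> ?B. card T = m}. signed_count k r {1..card T})"
    using finB by (intro sum.group[symmetric]) auto
  also have "\<dots> = (\<Sum>m\<le>2 * k * r. signed_count k r {1..m} * of_nat (q choose m))"
  proof (rule sum.cong[OF refl])
    fix m assume "m \<in> {..2 * k * r}"
    then have "{T \<in> ?B. card T = m} = {T. T \<subseteq> {1..q} \<and> card T = m}" by auto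
    then show "(\<Sum>T\<in>{T \<in> ?B. card T = m}. signed_count k r {1..card T}) =
        signed_count k r {1..m} * of_nat (q choose m)"
      using n_subsets[of "{1..q}" m] by simp
  qed
  also have "\<dots> = poly (\<Sum>m\<le>2 * k * r. smult (signed_count k r {1..m}) (binom_poly m)) (of_nat q)"
    by (simp add: poly_sum poly_binom_poly binomial_gbinomial)
  finally show ?thesis
    using desc_coeff_chromatic_poly[OF finite_johnson_vertices irrefl_johnson_edges[OF assms]]
    by simp
qed

lemma numerical_binom_poly: "numerical_poly (binom_poly k)"
  unfolding numerical_poly_def poly_binom_poly of_int_gbinomial[symmetric] by simp

theorem corollary31:
  fixes k :: nat
  assumes "k \<ge> 1"
  shows "two_level_poly (binom_poly k) (\<lambda>_. \<infinity>)
           (\<lambda>q. chromatic_poly (johnson_vertices q k) (johnson_adj k))"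
proof -
  let ?f = "\<lambda>q. chromatic_poly (johnson_vertices q k) (johnson_adj k)"
  have binom: "poly (binom_poly k) (of_nat q) = of_nat (q choose k)" for q
    by (simp add: poly_binom_poly binomial_gbinomial)
  have "?f q \<noteq> 0" "of_nat (degree (?f q)) = poly (binom_poly k) (of_nat q)" for q
    using degree_chromatic_poly[OF finite_johnson_vertices irrefl_johnson_edges[OF assms]]
    by (simp_all add: binom card_johnson_vertices)
  moreover have "\<exists>\<phi>. \<forall>q r. desc_coeff (?f q) r = poly (\<phi> r) (of_nat q)"
    by (intro exI allI) (rule desc_coeff_johnson[OF assms])
  ultimately show ?thesis
    unfolding two_level_poly_def using numerical_binom_poly by (auto simp: binom)
qed

end
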